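(* Let $0<\alpha<1$, and let $D\subset\mathbb R$ be nonempty, bounded, and not uniformly disconnected. Then there exists an $\alpha$-Hölder map $$\mathcal F:D\to\mathcal K\bigl(c_0(\mathbb R^2)\bigr)$$ that admits no $\alpha$-Hölder selection.
   Context: $c_0(\mathbb R^2)$ is the Banach space of all sequences $x=(x_n)_{n\ge1}$ with $x_n\in\mathbb R^2$ and $\|x_n\|\to0$ (Euclidean norm on $\mathbb R^2$), with norm $\|x\|_\infty=\sup_{n\ge1}\|x_n\|$. For a metric space $X$, $\mathcal K(X)$ is the family of nonempty compact subsets of $X$, with Hausdorff distance $d_H$. A map $F:D\to\mathcal K(X)$ is $\alpha$-Hölder if there is $L\ge0$ with $d_H(F(u),F(v))\le L|u-v|^\alpha$ for all $u,v\in D$; a map $f:D\to X$ is $\alpha$-Hölder if the same holds with the metric of $X$ in place of $d_H$. A selection of $F$ is a map $f:D\to X$ with $f(u)\in F(u)$ for every $u\in D$. For $c\in(0,1]$, $D$ is $c$-uniformly disconnected if, for every pair of distinct points $u,v\in D$ and every finite chain $u=u_0,u_1,\ldots,u_N=v$ with all $u_i\in D$, one has $\max_{1\le i\le N}|u_i-u_{i-1}|\ge c|u-v|$. $D$ is uniformly disconnected if it is $c$-uniformly disconnected for some $c\in(0,1]$. *)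

theory Defs
  imports "HOL-Analysis.Analysis"
begin

text \<open>
  The space of null sequences in the plane, as a subset of the bounded functions on
  the discrete space \<^typ>\<open>nat\<close>, whose library norm is the supremum norm. Sequences are
  indexed from 0 instead of 1. The lemmas below show that no null sequence is missing,
  that the norm is the intended one, and that the subset is a Banach space in it.
\<close>

definition c0 :: "(nat \<Rightarrow>\<^sub>C (real^2)) set" where
  "c0 = {x. (\<lambda>n. apply_bcontfun x n) \<longlonglongrightarrow> 0}"

lemma image_apply_c0: "apply_bcontfun ` c0 = {x. x \<longlonglongrightarrow> 0}"
proof
  show "{x. x \<longlonglongrightarrow> 0} \<subseteq> apply_bcontfun ` c0"
  proof
    fix x :: "nat \<Rightarrow> real^2" assume "x \<in> {x. x \<longlonglongrightarrow> 0}"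
    then have x: "x \<longlonglongrightarrow> 0" by simp
    then have "x \<in> bcontfun"
      using convergent_imp_bounded by (auto simp: bcontfun_def)
    then obtain y where "x = apply_bcontfun y" by (rule bcontfunE)
    with x show "x \<in> apply_bcontfun ` c0" by (auto simp: c0_def)
  qed
qed (auto simp: c0_def)

lemma norm_eq_SUP: "norm x = (SUP n. norm (apply_bcontfun x n))"
  for x :: "nat \<Rightarrow>\<^sub>C (real^2)"
  by (simp add: norm_bcontfun_def dist_bcontfun.rep_eq)

lemma subspace_c0: "subspace c0"
  unfolding subspace_def
proof (intro conjI ballI allI)
  show "0 \<in> c0" by (simp add: c0_def)
next
  fix x y assume "x \<in> c0" "y \<in> c0"
  then show "x + y \<in> c0" by (simp add: c0_def tendsto_add_zero)
next
  fix r x assume "x \<in> c0"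
  then show "r *\<^sub>R x \<in> c0"
    using tendsto_scaleR[OF tendsto_const, of "apply_bcontfun x" 0 sequentially r]
    by (simp add: c0_def)
qed

lemma complete_c0: "complete c0"
proof -
  have "closed c0"
    unfolding closed_sequential_limits
  proof (intro allI impI, elim conjE)
    fix X and l :: "nat \<Rightarrow>\<^sub>C (real^2)"
    assume X: "\<forall>n. X n \<in> c0" and l: "X \<longlonglongrightarrow> l"
    have "\<exists>N. \<forall>n\<ge>N. dist (apply_bcontfun l n) 0 < e" if "e > 0" for e
    proof -
      obtain k where k: "dist (X k) l < e/2"
        using l \<open>e > 0\<close> unfolding lim_sequentially
        by (elim allE[of _ "e/2"]) auto
      obtain N where N: "\<And>n. n \<ge> N \<Longrightarrow> dist (apply_bcontfun (X k) n) 0 < e/2"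
      proof -
        have "apply_bcontfun (X k) \<longlonglongrightarrow> 0" using X by (simp add: c0_def)
        then have "\<exists>N. \<forall>n\<ge>N. dist (apply_bcontfun (X k) n) 0 < e/2"
          using \<open>e > 0\<close> unfolding lim_sequentially by (elim allE[of _ "e/2"]) simp
        with that show thesis by blast
      qed
      have "dist (apply_bcontfun l n) 0 < e" if "n \<ge> N" for n
        using dist_triangle[of "apply_bcontfun l n" 0 "apply_bcontfun (X k) n"]
          dist_bounded[of "X k" n l] k N[OF that]
        by (simp add: dist_commute)
      then show ?thesis by blast
    qed
    then show "l \<in> c0" by (simp add: c0_def lim_sequentially)
  qed
  show ?thesis
    unfolding complete_def
  proof (intro allI impI, elim conjE)
    fix f :: "nat \<Rightarrow> nat \<Rightarrow>\<^sub>C (real^2)"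
    assume f: "\<forall>n. f n \<in> c0" and "Cauchy f"
    then obtain g where "uniform_limit UNIV f g sequentially"
      using uniformly_convergent_eq_cauchy[of "\<lambda>_. True" f]
      unfolding Cauchy_def uniform_limit_sequentially_iff
      by (metis dist_fun_lt_imp_dist_val_lt)
    from uniform_limit_bcontfunE[OF this sequentially_bot]
    obtain l where "f \<longlonglongrightarrow> l" by metis
    with f \<open>closed c0\<close> show "\<exists>l\<in>c0. f \<longlonglongrightarrow> l"
      using closed_sequentially by blast
  qed
qed

definition nonempty_compacts :: "'a::topological_space set \<Rightarrow> 'a set set" where
  "nonempty_compacts X = {K. K \<subseteq> X \<and> K \<noteq> {} \<and> compact K}"

text \<open>Only meaningful on nonempty bounded sets, where the suprema are over nonempty sets
  bounded above.\<close>

definition hausdorff_dist :: "'a::metric_space set \<Rightarrow> 'a set \<Rightarrow> real" where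
  "hausdorff_dist A B = max (SUP a\<in>A. infdist a B) (SUP b\<in>B. infdist b A)"

text \<open>The distance on the codomain is a parameter, so that the same notion covers point
  maps (\<^const>\<open>dist\<close>) and set-valued maps (\<^const>\<open>hausdorff_dist\<close>).\<close>

definition holder_on :: "('b \<Rightarrow> 'b \<Rightarrow> real) \<Rightarrow> real \<Rightarrow> real set \<Rightarrow> (real \<Rightarrow> 'b) \<Rightarrow> bool" where
  "holder_on d \<alpha> D f \<longleftrightarrow>
     (\<exists>L\<ge>0. \<forall>u\<in>D. \<forall>v\<in>D. d (f u) (f v) \<le> L * \<bar>u - v\<bar> powr \<alpha>)"

definition selection_on :: "'a set \<Rightarrow> ('a \<Rightarrow> 'b set) \<Rightarrow> ('a \<Rightarrow> 'b) \<Rightarrow> bool" where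
  "selection_on D F f \<longleftrightarrow> (\<forall>u\<in>D. f u \<in> F u)"

text \<open>Since the endpoints of the chain are distinct, \<open>N \<ge> 1\<close>, so the maximum is over a
  nonempty set.\<close>

definition c_uniformly_disconnected :: "real \<Rightarrow> real set \<Rightarrow> bool" where
  "c_uniformly_disconnected c D \<longleftrightarrow>
     (\<forall>u\<in>D. \<forall>v\<in>D. u \<noteq> v \<longrightarrow>
       (\<forall>N (w :: nat \<Rightarrow> real). w 0 = u \<and> w N = v \<and> (\<forall>i\<le>N. w i \<in> D) \<longrightarrow>
          (MAX i\<in>{1..N}. \<bar>w i - w (i - 1)\<bar>) \<ge> c * \<bar>u - v\<bar>))"

definition uniformly_disconnected :: "real set \<Rightarrow> bool" where
  "uniformly_disconnected D \<longleftrightarrow> (\<exists>c. 0 < c \<and> c \<le> 1 \<and> c_uniformly_disconnected c D)"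

end

theory Submission
  imports Defs
begin

text \<open>
  A circle of radius \<open>r\<close> with a narrow gap of angular half-width \<open>d\<close> is within \<open>r * d\<close> of the
  whole circle, so the gap may rotate fast at little Hausdorff cost: two full turns over a length
  \<open>h\<close> have Hoelder constant about \<open>r * d powr (1 - \<alpha>) / h powr \<alpha>\<close>. A selection that follows a
  sufficiently fine chain of \<open>D\<close> across this length cannot jump over the gap and is pushed around
  the circle, which forces a Hoelder constant of at least \<open>r / h powr \<alpha>\<close>. With
  \<open>r = h powr \<alpha> / d powr (1 - \<alpha>)\<close> the map stays uniformly Hoelder while the selection
  constant grows like \<open>d powr (\<alpha> - 1)\<close>, and shrinking \<open>h\<close> makes \<open>r\<close> as small as we like.
  Such maps with \<open>d\<close> and \<open>r\<close> tending to 0 are the coordinates of a map into \<open>c0\<close>.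
\<close>

section \<open>Chords of the unit circle and circles with a gap\<close>

definition circ :: "real \<Rightarrow> real^2" where
  "circ a = vector [cos a, sin a]"

lemma norm_circ: "norm (circ a) = 1"
  by (simp add: circ_def norm_vec_def L2_set_def sum_2)

lemma dist_circ: "dist (circ a) (circ b) = 2 * \<bar>sin ((a - b) / 2)\<bar>"
proof -
  define c where "c = (a - b) / 2"
  then have c: "a - b = 2 * c" by simp
  have "(cos a - cos b)\<^sup>2 + (sin a - sin b)\<^sup>2
      = (sin a)\<^sup>2 + (cos a)\<^sup>2 + ((sin b)\<^sup>2 + (cos b)\<^sup>2) - 2 * cos (a - b)"
    by (simp add: cos_diff power2_eq_square algebra_simps)
  also have "\<dots> = (2 * \<bar>sin c\<bar>)\<^sup>2"
    unfolding c cos_double_sin by (simp add: power_mult_distrib)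
  finally show ?thesis
    unfolding c_def[symmetric]
    by (simp add: circ_def dist_vec_def L2_set_def sum_2 dist_real_def real_sqrt_mult)
qed

lemma dist_circ_le: "dist (circ a) (circ b) \<le> \<bar>a - b\<bar>"
  using abs_sin_x_le_abs_x[of "(a - b) / 2"] by (simp add: dist_circ)

lemma dist_scaleR_left: "dist (r *\<^sub>R x) (r *\<^sub>R y) = \<bar>r\<bar> * dist x y"
  for x y :: "'a::real_normed_vector"
  by (simp add: dist_norm flip: scaleR_diff_right)

lemma continuous_on_circ: "continuous_on S circ"
  unfolding continuous_on_iff
  using dist_circ_le by (metis dist_real_def order_le_less_trans)

text \<open>The gap is centred at the angle \<open>a\<close> and has half-width \<open>d\<close>.
  With real angles instead of angles modulo 2 pi, a point can be lifted into a window that moves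
  with \<open>a\<close>.\<close>

definition cut_circle :: "real \<Rightarrow> real \<Rightarrow> real \<Rightarrow> (real^2) set" where
  "cut_circle r d a = (\<lambda>p. r *\<^sub>R circ p) ` {a + d..a + 2 * pi - d}"

lemma compact_cut_circle: "compact (cut_circle r d a)"
  unfolding cut_circle_def
  by (intro compact_continuous_image continuous_intros continuous_on_circ) auto

lemma cut_circle_nonempty: "d \<le> pi \<Longrightarrow> cut_circle r d a \<noteq> {}"
  by (simp add: cut_circle_def)

lemma norm_cut_circle: "x \<in> cut_circle r d a \<Longrightarrow> 0 \<le> r \<Longrightarrow> norm x = r"
  by (auto simp: cut_circle_def norm_circ)

text \<open>Reduce \<open>p\<close> modulo 2 pi to the window starting at \<open>a\<close>; if it
  then falls in the gap, move it to the nearer end.\<close>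

lemma circ_near_arc:
  assumes "0 \<le> d" "d \<le> pi"
  obtains q where "q \<in> {a + d..a + 2 * pi - d}" "dist (circ p) (circ q) \<le> d"
proof -
  define k where "k = \<lfloor>(p - a) / (2 * pi)\<rfloor>"
  define p' where "p' = p - 2 * pi * of_int k"
  have "of_int k \<le> (p - a) / (2 * pi)" "(p - a) / (2 * pi) < of_int k + 1"
    unfolding k_def by linarith+
  then have p': "a \<le> p'" "p' < a + 2 * pi"
    by (simp_all add: p'_def field_simps)
  have "sin ((p - p') / 2) = 0"
    by (simp add: p'_def sin_zero_iff_int2)
  then have eq: "circ p = circ p'"
    using dist_circ[of p p'] by simp
  show thesis
  proof (cases "p' < a + d")
    case True
    then show ?thesis
      using that[of "a + d"] dist_circ_le[of p' "a + d"] assms p' eq by simp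
  next
    case False
    note F = this
    show ?thesis
    proof (cases "p' > a + 2 * pi - d")
      case True
      then show ?thesis
        using that[of "a + 2 * pi - d"] dist_circ_le[of p' "a + 2 * pi - d"] assms p' eq by simp
    next
      case False
      with F show ?thesis
        using that[of p'] assms eq by simp
    qed
  qed
qed

text \<open>Two moves are possible: to the nearest point of the new arc, at cost at most
  \<open>r * d\<close>, or a rotation along with the gap, at cost at most
  \<open>r * \<bar>a - b\<bar>\<close>. The minimum takes the cheaper one.\<close>

lemma cut_circle_transport:
  assumes "0 \<le> d" "d \<le> pi" "0 \<le> r" "x \<in> cut_circle r d a"
  obtains y where "y \<in> cut_circle r d b" "dist x y \<le> r * min d \<bar>a - b\<bar>"
proof -
  obtain p where p: "p \<in> {a + d..a + 2 * pi - d}" "x = r *\<^sub>R circ p"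
    using assms by (auto simp: cut_circle_def)
  have "\<exists>q\<in>{b + d..b + 2 * pi - d}. dist (circ p) (circ q) \<le> min d \<bar>a - b\<bar>"
  proof (cases "d \<le> \<bar>a - b\<bar>")
    case True
    then show ?thesis
      using circ_near_arc[OF assms(1,2), of b p] by (metis min_absorb1)
  next
    case False
    then show ?thesis
      using p dist_circ_le[of p "p - a + b"] by (intro bexI[of _ "p - a + b"]) auto
  qed
  then obtain q where q: "q \<in> {b + d..b + 2 * pi - d}" "dist (circ p) (circ q) \<le> min d \<bar>a - b\<bar>"
    by blast
  show thesis
  proof
    show "r *\<^sub>R circ q \<in> cut_circle r d b"
      using q by (auto simp: cut_circle_def)
    show "dist x (r *\<^sub>R circ q) \<le> r * min d \<bar>a - b\<bar>"
      using mult_left_mono[OF q(2) \<open>0 \<le> r\<close>] \<open>0 \<le> r\<close> by (simp add: p(2) dist_scaleR_left)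
  qed
qed

text \<open>Turns the bound of \<open>cut_circle_transport\<close> into a Hoelder bound. The minimum
  is its own weighted geometric mean, and each factor only grows when \<open>a\<close> or
  \<open>b\<close> replaces it.\<close>

lemma min_le_weighted_geo_mean:
  fixes a b t :: real
  assumes "0 \<le> a" "0 \<le> b" "0 \<le> t" "t \<le> 1"
  shows "min a b \<le> a powr (1 - t) * b powr t"
proof -
  have "min a b = min a b powr (1 - t) * min a b powr t"
    using assms by (simp flip: powr_add add: min_def)
  also have "\<dots> \<le> a powr (1 - t) * b powr t"
    using assms by (intro mult_mono powr_mono2) auto
  finally show ?thesis .
qed

section \<open>Discrete winding: angles carried along by the gap\<close>

lemma first_crossing:
  fixes f :: "nat \<Rightarrow> real"
  assumes "f 0 < c" "c \<le> f n" and step: "\<And>i. i < n \<Longrightarrow> \<bar>f (Suc i) - f i\<bar> < d"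
  obtains i where "i \<le> n" "c \<le> f i" "f i < c + d"
proof -
  \<comment> \<open>By minimality the previous value is below \<open>c\<close>, so the step
    overshoots by less than \<open>d\<close>.\<close>
  define i where "i = (LEAST i. c \<le> f i)"
  have i: "c \<le> f i" "i \<le> n"
    unfolding i_def using assms(2) by (auto intro: LeastI Least_le)
  with assms(1) obtain j where j: "i = Suc j"
    by (cases i) auto
  then have "f j < c"
    using not_less_Least[of j "\<lambda>i. c \<le> f i"] by (simp add: i_def)
  with step[of j] i j that[of i] show thesis
    by auto
qed

text \<open>Jumping over the gap would need a longer chord, so the lifted angles \<open>p\<close>
  move by less than \<open>d\<close> per step. Two turns of the gap take \<open>p\<close> from below
  2 pi to above 4 pi, wherever it lies in its window. Hence it passes near 2 pi and near 3 pi, at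
  roughly opposite points, both strictly during the turning.\<close>

lemma pushed_by_gap:
  fixes a p :: "nat \<Rightarrow> real"
  assumes d: "0 < d" "d \<le> 1"
    and a: "a 0 = 0" "a n = 4 * pi"
    and p: "\<And>i. i \<le> n \<Longrightarrow> p i \<in> {a i + d..a i + 2 * pi - d}"
    and step_a: "\<And>i. i < n \<Longrightarrow> \<bar>a (Suc i) - a i\<bar> \<le> d"
    and step_p: "\<And>i. i < n \<Longrightarrow> dist (circ (p (Suc i))) (circ (p i)) < 2 * sin (d / 2)"
  obtains i j where "i \<le> n" "j \<le> n" "0 < a i" "a i < 4 * pi" "0 < a j" "a j < 4 * pi"
    "1 \<le> dist (circ (p i)) (circ (p j))"
proof -
  note pi_gt3
  have step: "\<bar>p (Suc i) - p i\<bar> < d" if "i < n" for i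
  proof (rule ccontr)
    assume "\<not> ?thesis"
    moreover define x where "x = \<bar>p (Suc i) - p i\<bar> / 2"
    ultimately have "d / 2 \<le> x" by simp
    \<comment> \<open>Consecutive windows have length \<open>2 * pi - 2 * d\<close> and are shifted
      by at most \<open>d\<close>. Between \<open>d / 2\<close> and \<open>pi - d / 2\<close> the
      sine is smallest at the ends.\<close>
    have "x \<le> pi - d / 2"
      using p[of i] p[of "Suc i"] step_a[of i] that by (auto simp: x_def)
    have "sin (d / 2) \<le> sin x"
    proof (cases "x \<le> pi / 2")
      case True
      then show ?thesis
        using \<open>d / 2 \<le> x\<close> d \<open>pi > 3\<close> by (intro sin_monotone_2pi_le) auto
    next
      case False
      then have "sin (d / 2) \<le> sin (pi - x)"
        using \<open>x \<le> pi - d / 2\<close> d \<open>pi > 3\<close> by (intro sin_monotone_2pi_le) auto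
      then show ?thesis by simp
    qed
    moreover have "dist (circ (p (Suc i))) (circ (p i)) = 2 * \<bar>sin x\<bar>"
    proof (cases "p i \<le> p (Suc i)")
      case True
      then show ?thesis by (simp add: dist_circ x_def)
    next
      case False
      then show ?thesis by (subst dist_commute) (simp add: dist_circ x_def)
    qed
    ultimately show False
      using step_p[OF that] by linarith
  qed
  have p0: "p 0 < 2 * pi" and pn: "4 * pi \<le> p n"
    using p[of 0] p[of n] a d by auto
  obtain i where i: "i \<le> n" "2 * pi \<le> p i" "p i < 2 * pi + d"
    using first_crossing[of p "2 * pi" n d] p0 pn step \<open>pi > 3\<close> by auto
  obtain j where j: "j \<le> n" "3 * pi \<le> p j" "p j < 3 * pi + d"
    using first_crossing[of p "3 * pi" n d] p0 pn step \<open>pi > 3\<close> by auto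
  show thesis
  proof
    show "i \<le> n" "j \<le> n" by fact+
    show "0 < a i" "a i < 4 * pi" "0 < a j" "a j < 4 * pi"
      using p[of i] p[of j] i j d \<open>pi > 3\<close> by auto
    \<comment> \<open>\<open>p j - p i\<close> differs from pi by less than \<open>d\<close>, so
      \<open>y\<close> is small, and \<open>cos y\<close> is the sine of the half angle.\<close>
    define y where "y = pi / 2 - (p j - p i) / 2"
    have "\<bar>y\<bar> \<le> 1 / 2"
      using i j d unfolding y_def abs_le_iff by (simp add: field_simps)
    also have "1 / 2 \<le> pi / 3"
      using \<open>pi > 3\<close> by simp
    finally have "\<bar>y\<bar> \<le> pi / 3" .
    then have "cos (pi / 3) \<le> cos \<bar>y\<bar>"
      using \<open>pi > 3\<close> by (intro cos_monotone_0_pi_le) auto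
    then have "1 / 2 \<le> sin ((p j - p i) / 2)"
      by (simp add: cos_60 y_def cos_diff)
    then show "1 \<le> dist (circ (p i)) (circ (p j))"
      by (subst dist_commute) (simp add: dist_circ)
  qed
qed

section \<open>Fine chains in \<open>D\<close> and the motion of the gap\<close>

lemma not_uniformly_disconnected_chain:
  assumes "\<not> uniformly_disconnected D" "0 < c" "c \<le> 1"
  obtains w :: "nat \<Rightarrow> real" and n where "w 0 \<noteq> w n" "\<And>i. i \<le> n \<Longrightarrow> w i \<in> D"
    "\<And>i. i < n \<Longrightarrow> \<bar>w (Suc i) - w i\<bar> < c * \<bar>w n - w 0\<bar>"
proof -
  have "\<not> c_uniformly_disconnected c D"
    using assms by (auto simp: uniformly_disconnected_def)
  then obtain n and w :: "nat \<Rightarrow> real" where w: "w 0 \<noteq> w n" "\<And>i. i \<le> n \<Longrightarrow> w i \<in> D"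
    and M: "(MAX i\<in>{1..n}. \<bar>w i - w (i - 1)\<bar>) < c * \<bar>w 0 - w n\<bar>"
    unfolding c_uniformly_disconnected_def by (auto simp: not_le)
  show thesis
  proof
    fix i assume "i < n"
    then have "\<bar>w (Suc i) - w i\<bar> \<le> (MAX i\<in>{1..n}. \<bar>w i - w (i - 1)\<bar>)"
      by (intro Max_ge) (auto intro!: image_eqI[of _ _ "Suc i"])
    with M show "\<bar>w (Suc i) - w i\<bar> < c * \<bar>w n - w 0\<bar>"
      by (simp add: abs_minus_commute)
  qed (use w in auto)
qed

text \<open>The centre of the gap at time \<open>t\<close>: two full turns between \<open>u\<close>
  and \<open>u + h\<close>. A negative \<open>h\<close> is allowed, since a chain may run to the
  left.\<close>

definition ramp :: "real \<Rightarrow> real \<Rightarrow> real \<Rightarrow> real" where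
  "ramp u h t = 4 * pi * max 0 (min 1 ((t - u) / h))"

text \<open>Clamping to [0, 1] does not increase distances, and 16 is a round bound for
  \<open>4 * pi\<close>.\<close>

lemma ramp_Lipschitz:
  assumes "h \<noteq> 0"
  shows "\<bar>ramp u h s - ramp u h t\<bar> \<le> 16 * (\<bar>s - t\<bar> / \<bar>h\<bar>)"
proof -
  define x y where "x = (s - u) / h" and "y = (t - u) / h"
  have "\<bar>ramp u h s - ramp u h t\<bar> = 4 * pi * \<bar>max 0 (min 1 x) - max 0 (min 1 y)\<bar>"
    unfolding ramp_def x_def y_def by (simp add: abs_mult flip: right_diff_distrib)
  also have "\<dots> \<le> 16 * \<bar>x - y\<bar>"
    using pi_less_4 by (intro mult_mono) auto
  also have "\<bar>x - y\<bar> = \<bar>s - t\<bar> / \<bar>h\<bar>"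
    by (simp add: x_def y_def flip: diff_divide_distrib abs_divide)
  finally show ?thesis .
qed

lemma ramp_strictly_between:
  assumes "0 < ramp u h t" "ramp u h t < 4 * pi"
  shows "0 < (t - u) / h" "(t - u) / h < 1"
  using assms pi_gt_zero by (auto simp: ramp_def max_def min_def less_le split: if_splits)

text \<open>Strict bounds exclude the constant stretches of \<open>ramp\<close>, so both times lie
  in the turning interval.\<close>

lemma dist_between_ramp:
  assumes "h \<noteq> 0" "0 < ramp u h s" "ramp u h s < 4 * pi" "0 < ramp u h t" "ramp u h t < 4 * pi"
  shows "\<bar>s - t\<bar> \<le> \<bar>h\<bar>"
proof -
  have "\<bar>(s - u) / h - (t - u) / h\<bar> \<le> 1"
    using ramp_strictly_between[OF assms(2,3)] ramp_strictly_between[OF assms(4,5)] by linarith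
  then show ?thesis
    using \<open>h \<noteq> 0\<close> by (simp add: field_simps flip: diff_divide_distrib)
qed

section \<open>The planar set-valued maps\<close>

lemma cut_circle_ramp_Holder:
  assumes \<alpha>: "0 < \<alpha>" "\<alpha> < 1" and d: "0 < d" "d \<le> 1" and "h \<noteq> 0"
    and r: "r = \<bar>h\<bar> powr \<alpha> / d powr (1 - \<alpha>)" and x: "x \<in> cut_circle r d (ramp u h s)"
  obtains y where "y \<in> cut_circle r d (ramp u h t)" "dist x y \<le> 16 * \<bar>s - t\<bar> powr \<alpha>"
proof -
  have "0 \<le> r" by (simp add: r)
  then obtain y where y: "y \<in> cut_circle r d (ramp u h t)"
    "dist x y \<le> r * min d \<bar>ramp u h s - ramp u h t\<bar>"
    using cut_circle_transport[of d r x "ramp u h s" "ramp u h t"] d x pi_gt3 by auto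
  note y(2)
  also have "r * min d \<bar>ramp u h s - ramp u h t\<bar> \<le> r * min d (16 * (\<bar>s - t\<bar> / \<bar>h\<bar>))"
    using ramp_Lipschitz[OF \<open>h \<noteq> 0\<close>, of u s t] \<open>0 \<le> r\<close> by (intro mult_left_mono) linarith+
  also have "\<dots> \<le> r * (d powr (1 - \<alpha>) * (16 * (\<bar>s - t\<bar> / \<bar>h\<bar>)) powr \<alpha>)"
    using \<alpha> d \<open>0 \<le> r\<close> by (intro mult_left_mono min_le_weighted_geo_mean) auto
  \<comment> \<open>The radius \<open>r\<close> is chosen for this exact cancellation; what remains
    depends on neither \<open>d\<close> nor \<open>h\<close>.\<close>
  also have "\<dots> = 16 powr \<alpha> * \<bar>s - t\<bar> powr \<alpha>"
    using d \<open>h \<noteq> 0\<close> by (simp add: r powr_mult powr_divide)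
  also have "\<dots> \<le> 16 powr 1 * \<bar>s - t\<bar> powr \<alpha>"
    using \<alpha> by (intro mult_right_mono powr_mono) auto
  finally show thesis
    using that y(1) by simp
qed

text \<open>The gap forces two values of \<open>g\<close> at distance at least \<open>r\<close>, at
  times at most \<open>\<bar>h\<bar>\<close> apart, while the constant \<open>M\<close> allows less
  than \<open>r\<close>. The fineness \<open>(d / 16) powr (1 / \<alpha>)\<close> of the chain
  serves twice: per step the gap turns by at most \<open>d\<close>, and \<open>g\<close> moves by
  less than \<open>r * (d / 16)\<close>.\<close>

lemma cut_circle_ramp_no_selection:
  assumes \<alpha>: "0 < \<alpha>" "\<alpha> < 1" and d: "0 < d" "d \<le> 1" and "0 \<le> M" "M * d powr (1 - \<alpha>) < 1"
    and l: "0 < l" "l \<le> 1"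
    and w: "w 0 \<noteq> w n"
      "\<And>i. i < n \<Longrightarrow> \<bar>w (Suc i) - w i\<bar> < l * (d / 16) powr (1 / \<alpha>) * \<bar>w n - w 0\<bar>"
    and h: "h = l * (w n - w 0)" and r: "r = \<bar>h\<bar> powr \<alpha> / d powr (1 - \<alpha>)"
    and g: "\<And>i. i \<le> n \<Longrightarrow> g (w i) \<in> cut_circle r d (ramp (w 0) h (w i))"
    and gM: "\<And>i j. i \<le> n \<Longrightarrow> j \<le> n \<Longrightarrow> dist (g (w i)) (g (w j)) \<le> M * \<bar>w i - w j\<bar> powr \<alpha>"
  shows False
proof -
  define a where "a i = ramp (w 0) h (w i)" for i
  have "h \<noteq> 0" using h w(1) l by simp
  have "0 < r" using \<open>h \<noteq> 0\<close> d by (simp add: r)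
  \<comment> \<open>Since \<open>r * d powr (1 - \<alpha>) = \<bar>h\<bar> powr \<alpha>\<close>,
    this is the hypothesis on \<open>M\<close> multiplied by \<open>r\<close>.\<close>
  have Mr: "M * \<bar>h\<bar> powr \<alpha> < r"
    using \<open>h \<noteq> 0\<close> d \<open>M * d powr (1 - \<alpha>) < 1\<close> by (simp add: r field_simps)
  have step: "\<bar>w (Suc i) - w i\<bar> \<le> (d / 16) powr (1 / \<alpha>) * \<bar>h\<bar>" if "i < n" for i
    using w(2)[OF that] l by (simp add: h abs_mult ac_simps)
  have "\<forall>i. \<exists>p. i \<le> n \<longrightarrow> p \<in> {a i + d..a i + 2 * pi - d} \<and> g (w i) = r *\<^sub>R circ p"
    using g by (fastforce simp: cut_circle_def a_def)
  then obtain p where p: "\<And>i. i \<le> n \<Longrightarrow> p i \<in> {a i + d..a i + 2 * pi - d}"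
    and gp: "\<And>i. i \<le> n \<Longrightarrow> g (w i) = r *\<^sub>R circ (p i)"
    by metis
  have dist_g: "dist (g (w i)) (g (w j)) = r * dist (circ (p i)) (circ (p j))"
    if "i \<le> n" "j \<le> n" for i j
    using that \<open>0 < r\<close> by (simp add: gp dist_scaleR_left)
  have a0: "a 0 = 0" by (simp add: a_def ramp_def)
  \<comment> \<open>Here \<open>(w n - w 0) / h = 1 / l\<close> is at least 1, so both turns are
    complete when the chain ends.\<close>
  have an: "a n = 4 * pi"
    using w(1) l by (simp add: a_def ramp_def h)
  have step_a: "\<bar>a (Suc i) - a i\<bar> \<le> d" if "i < n" for i
  proof -
    have "\<bar>a (Suc i) - a i\<bar> \<le> 16 * (\<bar>w (Suc i) - w i\<bar> / \<bar>h\<bar>)"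
      unfolding a_def by (rule ramp_Lipschitz) fact
    also have "\<dots> \<le> 16 * (d / 16) powr (1 / \<alpha>)"
      using step[OF that] \<open>h \<noteq> 0\<close> by (simp add: field_simps)
    also have "\<dots> \<le> 16 * (d / 16) powr 1"
      using \<alpha> d by (intro mult_left_mono powr_mono') auto
    finally show ?thesis using d by simp
  qed
  have step_p: "dist (circ (p (Suc i))) (circ (p i)) < 2 * sin (d / 2)" if "i < n" for i
  proof -
    have "r * dist (circ (p (Suc i))) (circ (p i)) \<le> M * \<bar>w (Suc i) - w i\<bar> powr \<alpha>"
      using gM[of "Suc i" i] dist_g[of "Suc i" i] that by simp
    also have "\<dots> \<le> M * ((d / 16) powr (1 / \<alpha>) * \<bar>h\<bar>) powr \<alpha>"
      using step[OF that] \<alpha> \<open>0 \<le> M\<close> by (intro mult_left_mono powr_mono2) auto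
    also have "\<dots> = (M * \<bar>h\<bar> powr \<alpha>) * (d / 16)"
      using \<alpha> d by (simp add: powr_mult powr_powr)
    also have "\<dots> < r * (d / 16)"
      using Mr d by simp
    finally have "dist (circ (p (Suc i))) (circ (p i)) < d / 16"
      using \<open>0 < r\<close> by simp
    \<comment> \<open>The mean value theorem gives \<open>sin (d / 2) \<ge> d / 4\<close>, as the
      cosine is at least 1/2 up to pi / 3.\<close>
    also have "d / 16 \<le> 2 * sin (d / 2)"
    proof -
      obtain z where z: "0 < z" "z < d / 2" "sin (d / 2) - sin 0 = (d / 2 - 0) * cos z"
        using MVT2[of 0 "d / 2" sin cos] d by (auto intro: DERIV_sin)
      have "cos (pi / 3) \<le> cos z"
        using z d pi_gt3 by (intro cos_monotone_0_pi_le) auto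
      then have "d / 2 * (1 / 2) \<le> d / 2 * cos z"
        unfolding cos_60 using d by (intro mult_left_mono) auto
      also have "\<dots> = sin (d / 2)"
        using z(3) by simp
      finally show ?thesis using d by simp
    qed
    finally show ?thesis .
  qed
  obtain i j where ij: "i \<le> n" "j \<le> n" "0 < a i" "a i < 4 * pi" "0 < a j" "a j < 4 * pi"
    "1 \<le> dist (circ (p i)) (circ (p j))"
    using pushed_by_gap[OF d a0 an p step_a step_p] by blast
  have "r \<le> dist (g (w i)) (g (w j))"
    using ij \<open>0 < r\<close> by (simp add: dist_g)
  also have "\<dots> \<le> M * \<bar>w i - w j\<bar> powr \<alpha>"
    using gM ij by simp
  also have "\<dots> \<le> M * \<bar>h\<bar> powr \<alpha>"
    using dist_between_ramp[OF \<open>h \<noteq> 0\<close>] ij \<alpha> \<open>0 \<le> M\<close>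
    by (intro mult_left_mono powr_mono2) (auto simp: a_def)
  finally show False using Mr by simp
qed

text \<open>The order of choices matters: first \<open>d\<close> from \<open>M\<close>, then
  \<open>l\<close> from \<open>d\<close>, \<open>e\<close> and a bound on the diameter of
  \<open>D\<close>, and only then the chain. Its span cannot be prescribed, so the turning length is
  the fraction \<open>l\<close> of it. The Hoelder constant 16 is the same for all \<open>M\<close>
  and \<open>e\<close>.\<close>

lemma planar_map_without_selection:
  fixes D :: "real set"
  assumes \<alpha>: "0 < \<alpha>" "\<alpha> < 1" and D: "bounded D" "\<not> uniformly_disconnected D"
    and "0 < e" "0 \<le> M"
  obtains G :: "real \<Rightarrow> (real^2) set" where "\<And>t. compact (G t)" "\<And>t. G t \<noteq> {}"
    "\<And>t x. x \<in> G t \<Longrightarrow> norm x \<le> e"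
    "\<And>s t x. x \<in> G s \<Longrightarrow> \<exists>y\<in>G t. dist x y \<le> 16 * \<bar>s - t\<bar> powr \<alpha>"
    "\<And>g. selection_on D G g \<Longrightarrow> \<exists>s\<in>D. \<exists>t\<in>D. M * \<bar>s - t\<bar> powr \<alpha> < dist (g s) (g t)"
proof -
  \<comment> \<open>Solves \<open>d powr (1 - \<alpha>) = 1 / (M + 1)\<close>, so that
    \<open>M * d powr (1 - \<alpha>)\<close> stays below 1.\<close>
  define d where "d = (1 / (M + 1)) powr (1 / (1 - \<alpha>))"
  have d: "0 < d" "d \<le> 1" "M * d powr (1 - \<alpha>) < 1"
    using \<alpha> \<open>0 \<le> M\<close> by (auto simp: d_def powr_powr intro: powr_le1)
  obtain B where B: "0 < B" "\<And>s t. s \<in> D \<Longrightarrow> t \<in> D \<Longrightarrow> \<bar>s - t\<bar> \<le> B"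
  proof -
    obtain B where "0 < B" "\<And>s. s \<in> D \<Longrightarrow> \<bar>s\<bar> \<le> B"
      using D(1) by (auto simp: bounded_pos)
    then have "\<bar>s - t\<bar> \<le> 2 * B" if "s \<in> D" "t \<in> D" for s t
      using that by (smt (verit))
    with \<open>0 < B\<close> that[of "2 * B"] show thesis by simp
  qed
  \<comment> \<open>The radius equals \<open>e\<close> when \<open>\<bar>h\<bar> = z\<close>. Spans
    are at most \<open>B\<close>, so the factor \<open>z / B\<close> keeps
    \<open>\<bar>h\<bar> \<le> z\<close>; the cap 1 leaves the chain long enough for both
    turns.\<close>
  define z where "z = (e * d powr (1 - \<alpha>)) powr (1 / \<alpha>)"
  define l where "l = min 1 (z / B)"
  have "0 < z" using \<open>0 < e\<close> d by (simp add: z_def)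
  then have l: "0 < l" "l \<le> 1" using B(1) by (auto simp: l_def)
  have "(d / 16) powr (1 / \<alpha>) \<le> 1"
    using d \<alpha> by (intro powr_le1) auto
  then have "l * (d / 16) powr (1 / \<alpha>) \<le> 1"
    using l by (simp add: mult_le_one)
  moreover have "0 < l * (d / 16) powr (1 / \<alpha>)"
    using l d by simp
  ultimately obtain w :: "nat \<Rightarrow> real" and n where w: "w 0 \<noteq> w n" "\<And>i. i \<le> n \<Longrightarrow> w i \<in> D"
    "\<And>i. i < n \<Longrightarrow> \<bar>w (Suc i) - w i\<bar> < l * (d / 16) powr (1 / \<alpha>) * \<bar>w n - w 0\<bar>"
    using not_uniformly_disconnected_chain[OF D(2)] by metis
  define h where "h = l * (w n - w 0)"
  define r where "r = \<bar>h\<bar> powr \<alpha> / d powr (1 - \<alpha>)"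
  have "h \<noteq> 0" using w(1) l by (simp add: h_def)
  have "0 \<le> r" by (simp add: r_def)
  have "r \<le> e"
  proof -
    have "\<bar>h\<bar> \<le> z / B * B"
      unfolding h_def abs_mult using l \<open>0 < z\<close> B w(2) by (intro mult_mono) (auto simp: l_def)
    then have "\<bar>h\<bar> powr \<alpha> \<le> z powr \<alpha>"
      using B(1) \<alpha> by (intro powr_mono2) auto
    also have "\<dots> = e * d powr (1 - \<alpha>)"
      using \<alpha> \<open>0 < e\<close> d by (simp add: z_def powr_powr)
    finally show ?thesis
      using d by (simp add: r_def field_simps)
  qed
  show thesis
  proof (rule that[of "\<lambda>t. cut_circle r d (ramp (w 0) h t)"])
    show "compact (cut_circle r d (ramp (w 0) h t))" for t
      by (rule compact_cut_circle)
    show "cut_circle r d (ramp (w 0) h t) \<noteq> {}" for t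
      using d pi_gt3 by (intro cut_circle_nonempty) auto
    show "norm x \<le> e" if "x \<in> cut_circle r d (ramp (w 0) h t)" for t x
      using norm_cut_circle[OF that \<open>0 \<le> r\<close>] \<open>r \<le> e\<close> by simp
    show "\<exists>y\<in>cut_circle r d (ramp (w 0) h t). dist x y \<le> 16 * \<bar>s - t\<bar> powr \<alpha>"
      if "x \<in> cut_circle r d (ramp (w 0) h s)" for s t x
      using cut_circle_ramp_Holder[OF \<alpha> d(1,2) \<open>h \<noteq> 0\<close> r_def that] by metis
    show "\<exists>s\<in>D. \<exists>t\<in>D. M * \<bar>s - t\<bar> powr \<alpha> < dist (g s) (g t)"
      if g: "selection_on D (\<lambda>t. cut_circle r d (ramp (w 0) h t)) g" for g
    proof (rule ccontr)
      assume "\<not> ?thesis"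
      then have "dist (g (w i)) (g (w j)) \<le> M * \<bar>w i - w j\<bar> powr \<alpha>" if "i \<le> n" "j \<le> n" for i j
        using that w(2) by (auto simp: not_less)
      moreover have "g (w i) \<in> cut_circle r d (ramp (w 0) h (w i))" if "i \<le> n" for i
        using g w(2) that by (simp add: selection_on_def)
      ultimately show False
        using cut_circle_ramp_no_selection[OF \<alpha> d(1,2) \<open>0 \<le> M\<close> d(3) l w(1,3) h_def r_def]
        by blast
    qed
  qed
qed

section \<open>Compact boxes in \<open>c0\<close>\<close>

definition c0_box :: "(nat \<Rightarrow> (real^2) set) \<Rightarrow> (nat \<Rightarrow>\<^sub>C (real^2)) set" where
  "c0_box K = {x \<in> c0. \<forall>n. apply_bcontfun x n \<in> K n}"

text \<open>The null sequence of bounds makes every coordinatewise choice a null sequence, so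
  coordinates can be chosen independently.\<close>

lemma c0_boxE:
  assumes "\<And>n. f n \<in> K n" "\<And>n x. x \<in> K n \<Longrightarrow> norm x \<le> e n" "e \<longlonglongrightarrow> 0"
  obtains x where "x \<in> c0_box K" "apply_bcontfun x = f"
proof -
  have "f \<longlonglongrightarrow> 0"
    by (rule tendsto_norm_zero_cancel, rule tendsto_sandwich[OF _ _ tendsto_const assms(3)])
      (use assms(1,2) in auto)
  then have "f \<in> apply_bcontfun ` c0"
    by (simp add: image_apply_c0)
  with that assms(1) show thesis
    by (auto simp: c0_box_def)
qed

text \<open>By Tychonoff the product of the \<open>K n\<close> is compact for coordinatewise
  convergence. Its tails are uniformly small, so there coordinatewise convergence implies
  convergence in norm, and the box is a continuous image of the product.\<close>

lemma compact_c0_box: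
  assumes K: "\<And>n. compact (K n)" and e: "\<And>n x. x \<in> K n \<Longrightarrow> norm x \<le> e n" "e \<longlonglongrightarrow> 0"
  shows "compact (c0_box K)"
proof -
  \<comment> \<open>\<open>Bcontfun\<close> is meaningful only on \<open>bcontfun\<close>; the
    product lies inside it, and there \<open>J\<close> inverts
    \<open>apply_bcontfun\<close>.\<close>
  define J :: "(nat \<Rightarrow> real^2) \<Rightarrow> (nat \<Rightarrow>\<^sub>C (real^2))" where "J = Bcontfun"
  have J: "apply_bcontfun (J f) = f" if "f \<in> Pi UNIV K" for f
    using that e c0_boxE[of f K e] by (metis J_def PiE UNIV_I apply_bcontfun_inverse)
  have "compact (Pi UNIV K)"
  proof -
    have "compactin (product_topology (\<lambda>_. euclidean) UNIV) (PiE UNIV K)"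
      using K by (simp add: compactin_PiE)
    then show ?thesis
      by (simp add: euclidean_product_topology PiE_UNIV_domain)
  qed
  moreover have "continuous_on (Pi UNIV K) J"
    unfolding continuous_on_def
  proof (intro ballI tendstoI)
    fix f and \<epsilon> :: real assume f: "f \<in> Pi UNIV K" and "0 < \<epsilon>"
    \<comment> \<open>From \<open>N\<close> on, two points of the product are within
      \<open>\<epsilon> / 2\<close> by size alone; the finitely many earlier coordinates are handled
      by continuity of the projections.\<close>
    obtain N where N: "\<And>n. n \<ge> N \<Longrightarrow> e n < \<epsilon> / 4"
      using order_tendstoD(2)[OF e(2), of "\<epsilon> / 4"] \<open>0 < \<epsilon>\<close>
      unfolding eventually_sequentially by auto
    have "((\<lambda>g. g n) \<longlongrightarrow> f n) (at f within Pi UNIV K)" for n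
      using continuous_on_subset[OF continuous_on_product_coordinates[of n] subset_UNIV] f
      unfolding continuous_on_def by blast
    then have "\<forall>\<^sub>F g in at f within Pi UNIV K. dist (g n) (f n) < \<epsilon> / 2" for n
      using \<open>0 < \<epsilon>\<close> by (intro tendstoD) auto
    then have "\<forall>\<^sub>F g in at f within Pi UNIV K. \<forall>n\<in>{..<N}. dist (g n) (f n) < \<epsilon> / 2"
      by (intro eventually_ball_finite) auto
    then show "\<forall>\<^sub>F g in at f within Pi UNIV K. dist (J g) (J f) < \<epsilon>"
    proof (rule eventually_rev_mp[OF eventually_conj])
      show "\<forall>\<^sub>F g in at f within Pi UNIV K. g \<in> Pi UNIV K"
        by (simp add: eventually_at_filter)
      show "\<forall>\<^sub>F g in at f within Pi UNIV K.
          (\<forall>n\<in>{..<N}. dist (g n) (f n) < \<epsilon> / 2) \<and> g \<in> Pi UNIV K \<longrightarrow> dist (J g) (J f) < \<epsilon>"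
      proof (intro always_eventually allI impI, elim conjE)
        fix g assume g: "\<forall>n\<in>{..<N}. dist (g n) (f n) < \<epsilon> / 2" "g \<in> Pi UNIV K"
        have "dist (g n) (f n) \<le> \<epsilon> / 2" for n
        proof (cases "n < N")
          case True
          then show ?thesis using g(1) by (simp add: less_imp_le)
        next
          case False
          have "dist (g n) (f n) \<le> norm (g n) + norm (f n)"
            by (simp add: dist_norm norm_triangle_ineq4)
          also have "\<dots> \<le> e n + e n"
            using f g(2) by (intro add_mono e(1)) auto
          finally show ?thesis using N[of n] False by simp
        qed
        then have "dist (J g) (J f) \<le> \<epsilon> / 2"
          using J f g(2) by (intro dist_bound) simp
        then show "dist (J g) (J f) < \<epsilon>" using \<open>0 < \<epsilon>\<close> by simp
      qed
    qed
  qed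
  ultimately have "compact (J ` Pi UNIV K)"
    by (rule compact_continuous_image[rotated])
  also have "J ` Pi UNIV K = c0_box K"
  proof (intro equalityI subsetI)
    fix x assume "x \<in> J ` Pi UNIV K"
    then obtain f where f: "f \<in> Pi UNIV K" "x = J f" by blast
    then obtain y where "y \<in> c0_box K" "apply_bcontfun y = f"
      using c0_boxE[of f K e, OF _ e] by blast
    with f show "x \<in> c0_box K"
      by (metis J_def apply_bcontfun_inverse)
  next
    fix x assume "x \<in> c0_box K"
    then have "apply_bcontfun x \<in> Pi UNIV K" "x = J (apply_bcontfun x)"
      by (auto simp: c0_box_def J_def apply_bcontfun_inverse)
    then show "x \<in> J ` Pi UNIV K" by blast
  qed
  finally show ?thesis .
qed

section \<open>Hausdorff distance and the map into \<open>c0\<close>\<close>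

lemma hausdorff_dist_le:
  assumes "A \<noteq> {}" "B \<noteq> {}"
    and "\<And>a. a \<in> A \<Longrightarrow> \<exists>b\<in>B. dist a b \<le> c" "\<And>b. b \<in> B \<Longrightarrow> \<exists>a\<in>A. dist b a \<le> c"
  shows "hausdorff_dist A B \<le> c"
  unfolding hausdorff_dist_def
proof (intro max.boundedI cSUP_least)
  show "infdist a B \<le> c" if "a \<in> A" for a
    using assms(3)[OF that] infdist_le2 by blast
  show "infdist b A \<le> c" if "b \<in> B" for b
    using assms(4)[OF that] infdist_le2 by blast
qed fact+

theorem theorem4p3:
  fixes \<alpha> :: real and D :: "real set"
  assumes "0 < \<alpha>" and "\<alpha> < 1"
    and "D \<noteq> {}" and "bounded D" and "\<not> uniformly_disconnected D"
  shows "\<exists>F :: real \<Rightarrow> (nat \<Rightarrow>\<^sub>C (real^2)) set.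
           F \<in> D \<rightarrow> nonempty_compacts c0 \<and>
           holder_on hausdorff_dist \<alpha> D F \<and>
           \<not> (\<exists>f. selection_on D F f \<and> holder_on dist \<alpha> D f)"
proof -
  define e where "e n = inverse (real (Suc n))" for n
  have e: "e \<longlonglongrightarrow> 0" "0 < e n" for n
    unfolding e_def by (rule LIMSEQ_inverse_real_of_nat) simp
  \<comment> \<open>Coordinate \<open>n\<close> rules out the Hoelder constant \<open>n\<close>,
    while all coordinates share the constant 16.\<close>
  have "\<forall>n. \<exists>G :: real \<Rightarrow> (real^2) set. (\<forall>t. compact (G t)) \<and> (\<forall>t. G t \<noteq> {}) \<and>
      (\<forall>t. \<forall>x\<in>G t. norm x \<le> e n) \<and>
      (\<forall>s t. \<forall>x\<in>G s. \<exists>y\<in>G t. dist x y \<le> 16 * \<bar>s - t\<bar> powr \<alpha>) \<and>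
      (\<forall>g. selection_on D G g \<longrightarrow> (\<exists>s\<in>D. \<exists>t\<in>D. real n * \<bar>s - t\<bar> powr \<alpha> < dist (g s) (g t)))"
  proof
    fix n
    show "\<exists>G :: real \<Rightarrow> (real^2) set. (\<forall>t. compact (G t)) \<and> (\<forall>t. G t \<noteq> {}) \<and>
      (\<forall>t. \<forall>x\<in>G t. norm x \<le> e n) \<and>
      (\<forall>s t. \<forall>x\<in>G s. \<exists>y\<in>G t. dist x y \<le> 16 * \<bar>s - t\<bar> powr \<alpha>) \<and>
      (\<forall>g. selection_on D G g \<longrightarrow> (\<exists>s\<in>D. \<exists>t\<in>D. real n * \<bar>s - t\<bar> powr \<alpha> < dist (g s) (g t)))"
      using planar_map_without_selection[OF assms(1,2,4,5) e(2) of_nat_0_le_iff, of n n] by metis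
  qed
  then obtain G :: "nat \<Rightarrow> real \<Rightarrow> (real^2) set" where compact_G: "\<And>n t. compact (G n t)"
    and G_ne: "\<And>n t. G n t \<noteq> {}"
    and norm_G: "\<And>n t x. x \<in> G n t \<Longrightarrow> norm x \<le> e n"
    and G_Holder: "\<And>n s t x. x \<in> G n s \<Longrightarrow> \<exists>y\<in>G n t. dist x y \<le> 16 * \<bar>s - t\<bar> powr \<alpha>"
    and no_sel: "\<And>n g. selection_on D (G n) g \<Longrightarrow>
      \<exists>s\<in>D. \<exists>t\<in>D. real n * \<bar>s - t\<bar> powr \<alpha> < dist (g s) (g t)"
    by metis
  define F where "F t = c0_box (\<lambda>n. G n t)" for t
  have F_ne: "F t \<noteq> {}" for t
  proof -
    have "\<forall>n. \<exists>x. x \<in> G n t" using G_ne by (simp add: ex_in_conv)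
    then obtain f where "\<And>n. f n \<in> G n t" by metis
    then show ?thesis
      using c0_boxE[of f "\<lambda>n. G n t" e] norm_G e(1) unfolding F_def by (metis empty_iff)
  qed
  \<comment> \<open>Points are moved in each coordinate separately; the shared constant bounds the
    supremum.\<close>
  have transport: "\<exists>y\<in>F t. dist x y \<le> 16 * \<bar>s - t\<bar> powr \<alpha>" if "x \<in> F s" for x s t
  proof -
    have "\<forall>n. \<exists>y\<in>G n t. dist (apply_bcontfun x n) y \<le> 16 * \<bar>s - t\<bar> powr \<alpha>"
      using that G_Holder by (auto simp: F_def c0_box_def)
    then obtain f where f: "\<And>n. f n \<in> G n t"
      "\<And>n. dist (apply_bcontfun x n) (f n) \<le> 16 * \<bar>s - t\<bar> powr \<alpha>"
      by metis
    then obtain y where "y \<in> F t" "apply_bcontfun y = f"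
      using c0_boxE[of f "\<lambda>n. G n t" e] norm_G e(1) unfolding F_def by metis
    with f(2) show ?thesis
      by (intro bexI[of _ y] dist_bound) auto
  qed
  show ?thesis
  proof (intro exI conjI notI)
    show "F \<in> D \<rightarrow> nonempty_compacts c0"
      using F_ne compact_c0_box[OF compact_G norm_G e(1)]
      by (auto simp: nonempty_compacts_def F_def c0_box_def)
    have "hausdorff_dist (F s) (F t) \<le> 16 * \<bar>s - t\<bar> powr \<alpha>" for s t
      using F_ne transport[of _ s t] transport[of _ t s]
      by (intro hausdorff_dist_le) (auto simp: abs_minus_commute)
    then show "holder_on hausdorff_dist \<alpha> D F"
      unfolding holder_on_def by (intro exI[of _ 16]) auto
  next
    assume "\<exists>f. selection_on D F f \<and> holder_on dist \<alpha> D f"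
    then obtain f L where f: "selection_on D F f"
      and L: "\<And>s t. s \<in> D \<Longrightarrow> t \<in> D \<Longrightarrow> dist (f s) (f t) \<le> L * \<bar>s - t\<bar> powr \<alpha>"
      unfolding holder_on_def by blast
    \<comment> \<open>Evaluation at \<open>n\<close> sends selections of \<open>F\<close> to
      selections of \<open>G n\<close> and does not increase distances, so a coordinate with
      \<open>n\<close> at least \<open>L\<close> refutes \<open>L\<close>.\<close>
    obtain n :: nat where n: "L \<le> real n"
      using real_arch_simple by blast
    have "selection_on D (G n) (\<lambda>t. apply_bcontfun (f t) n)"
      using f by (simp add: selection_on_def F_def c0_box_def)
    then obtain s t where st: "s \<in> D" "t \<in> D"
      "real n * \<bar>s - t\<bar> powr \<alpha> < dist (apply_bcontfun (f s) n) (apply_bcontfun (f t) n)"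
      using no_sel by blast
    note st(3)
    also have "dist (apply_bcontfun (f s) n) (apply_bcontfun (f t) n) \<le> dist (f s) (f t)"
      by (rule dist_bounded)
    also have "\<dots> \<le> L * \<bar>s - t\<bar> powr \<alpha>" using L st by simp
    also have "\<dots> \<le> real n * \<bar>s - t\<bar> powr \<alpha>"
      using n by (intro mult_right_mono) auto
    finally show False by simp
  qed
qed

end
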